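(* Consider the mean field limit of the distributed storage system described in the context, with equilibrium workload CDF $F$ and $\bar F=1-F$. For $i\in\{h,c\}$ and $k_i\le j\le d_i$, let $\bar F_{R_{(j,k_i)}}$ be the complementary CDF of the download time of a type $i$ request which finds exactly $j$ of its $d_i$ servers available. Then for $w\ge0$ $$\bar F_{R_{(j,k_i)}}(w)=\bar G_i(w)+\int_0^w\bar F_{U_{(j,k_i)}}(u)\,g_i(w-u)\,du,\qquad \bar F_{U_{(j,k_i)}}(u)=\sum_{m=0}^{k_i-1}\binom{j}{m}\bar F(u)^{j-m}F(u)^{m}.$$ The download time $R_i$ of a type $i$ request, conditioned on at least $k_i$ of its $d_i$ servers being available, has complementary CDF $$\bar F_{R_i}(w)=\sum_{j=k_i}^{d_i}p^{(i)}_j\,\bar F_{R_{(j,k_i)}}(w),\qquad p^{(i)}_j=\frac{B_j(d_i)}{\sum_{l=k_i}^{d_i}B_l(d_i)},$$ and mean $\mathbb{E}[R_i]=\int_0^\infty\bar F_{R_i}(w)\,dw$. Moreover, the download time $R$ of an arbitrary request, conditioned on the request being successfully downloadable (i.e. being of some type $i$ with at least $k_i$ of its $d_i$ servers available), has complementary CDF $$\bar F_R(w)=\beta_h\bar F_{R_h}(w)+\beta_c\bar F_{R_c}(w),\qquad \beta_i=\frac{\tilde\beta_i}{\tilde\beta_h+\tilde\beta_c},\quad \tilde\beta_i=p_i\sum_{j=k_i}^{d_i}B_j(d_i).$$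
   Context: System. There are $N$ servers, each a FIFO queue working at unit rate. File requests arrive as a Poisson process of rate $\lambda N$. Each request is independently of type $i\in\{h,c\}$ (hot or cold) with probability $p_i$, $p_h+p_c=1$. A type $i$ request selects $d_i$ distinct servers uniformly at random. The integers $d_i,k_i$ satisfy $1\le k_i\le d_i$, and $k_h=1$. Each selected server is available (not failed) with probability $q\in(0,1]$, independently. Put $B_j(d)=\binom{d}{j}q^j(1-q)^{d-j}$. If exactly $j\ge1$ selected servers are available, the request is served on these by the policy LL$(j,\min\{j,k_i\})$: one fragment is served at each of the $\min\{j,k_i\}$ available servers having smallest workload (ties broken uniformly at random), and nothing at the others. The file can be reconstructed (the request succeeds) only if $j\ge k_i$. All fragments of one request have the same (identical) service time, distributed as $\hat X_i$ and independent of everything else. $\hat X_i=\delta_i+Y_i$ with $\delta_i\ge0$ constant and $Y_i$ phase-type; $\bar G_i$ and $g_i$ are its complementary CDF and density. Workload. The workload of a server is the pending work that will actually be served there, so a fragment served at a server with workload $u$ waits time $u$ before its service begins. In the limit $N\to\infty$ at equilibrium, the workloads of the selected servers seen by an arriving request are i.i.d. with common CDF $F$ (the equilibrium workload distribution), independent of server availability and of the service time $\hat X_i$ of the request. Download time. For a request of type $i$ finding exactly $j\ge k_i$ servers available, with workloads $U_1,\dots,U_j$, the download time is the time from arrival until all $k_i$ fragments have been downloaded; it equals $R_{(j,k_i)}=U_{(j,k_i)}+\hat X_i$, where $U_{(j,k_i)}$ is the $k_i$-th smallest of $U_1,\dots,U_j$ and $\bar F_{U_{(j,k_i)}}$ is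 its complementary CDF. *)

theory Defs
  imports "HOL-Probability.Probability" "Jordan_Normal_Form.Matrix"
begin

datatype req_type = Hot | Cold

definition avail_prob :: "real \<Rightarrow> nat \<Rightarrow> nat \<Rightarrow> real" where
  "avail_prob q d j = real (d choose j) * q ^ j * (1 - q) ^ (d - j)"

definition mat_exp :: "real mat \<Rightarrow> real mat" where
  "mat_exp A = mat (dim_row A) (dim_col A) (\<lambda>(i, j). \<Sum>n. (A ^\<^sub>m n) $$ (i, j) / fact n)"

text \<open>Generator of a continuous-time Markov chain restricted to its \<open>n\<close> transient states: the
  missing mass of a row is the rate of absorption, and invertibility says that absorption is
  certain from every state.\<close>

definition sub_generator :: "nat \<Rightarrow> real mat \<Rightarrow> bool" where
  "sub_generator n S \<longleftrightarrow>
     S \<in> carrier_mat n n \<and>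
     (\<forall>i<n. \<forall>j<n. i \<noteq> j \<longrightarrow> 0 \<le> S $$ (i, j)) \<and>
     (\<forall>i<n. (\<Sum>j<n. S $$ (i, j)) \<le> 0) \<and>
     invertible_mat S"

text \<open>Law of the absorption time, with initial distribution \<open>\<alpha>\<close> on the transient states (so there
  is no atom at 0): the probability of not being absorbed by time \<open>t\<close> is
  \<open>\<alpha> exp(t S) 1\<close>.\<close>

definition phase_type :: "real measure \<Rightarrow> bool" where
  "phase_type \<mu> \<longleftrightarrow>
     (\<exists>n \<alpha> S. \<alpha> \<in> carrier_vec n \<and> (\<forall>i<n. 0 \<le> vec_index \<alpha> i) \<and> (\<Sum>i<n. vec_index \<alpha> i) = 1 \<and>
        sub_generator n S \<and>
        (\<forall>t\<ge>0. measure \<mu> {t<..} =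
           scalar_prod \<alpha> (mat_exp (smult_mat t S) *\<^sub>v vec n (\<lambda>_. 1))))"

text \<open>The primitive random elements of a request, coded as real random variables so that their
  joint independence is an instance of \<open>indep_vars\<close>: the type \<open>T\<close>, the availability \<open>A s\<close> and the
  workload \<open>U s\<close> of the \<open>s\<close>-th selected server, and the service time \<open>X i\<close> that all fragments
  have if the request is of type \<open>i\<close>.\<close>

datatype source = RType | Avail nat | Load nat | Service req_type

fun source_var ::
  "('a \<Rightarrow> req_type) \<Rightarrow> (nat \<Rightarrow> 'a \<Rightarrow> bool) \<Rightarrow> (nat \<Rightarrow> 'a \<Rightarrow> real) \<Rightarrow> (req_type \<Rightarrow> 'a \<Rightarrow> real) \<Rightarrow>
   source \<Rightarrow> 'a \<Rightarrow> real" where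
  "source_var T A U X RType = (\<lambda>\<omega>. of_bool (T \<omega> = Hot))"
| "source_var T A U X (Avail s) = (\<lambda>\<omega>. of_bool (A s \<omega>))"
| "source_var T A U X (Load s) = U s"
| "source_var T A U X (Service i) = X i"

definition available :: "(nat \<Rightarrow> 'a \<Rightarrow> bool) \<Rightarrow> nat \<Rightarrow> 'a \<Rightarrow> nat set" where
  "available A d \<omega> = {s. s < d \<and> A s \<omega>}"

text \<open>The \<open>k\<close>-th smallest (counted from 1, with multiplicity) of the values \<open>u s\<close>, \<open>s \<in> S\<close>.\<close>

definition order_stat :: "(nat \<Rightarrow> real) \<Rightarrow> nat set \<Rightarrow> nat \<Rightarrow> real" where
  "order_stat u S k = sorted_list_of_multiset (image_mset u (mset_set S)) ! (k - 1)"

definition download_time :: "nat \<Rightarrow> (nat \<Rightarrow> real) \<Rightarrow> nat set \<Rightarrow> real \<Rightarrow> real" where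
  "download_time k u S x = order_stat u S k + x"

text \<open>\<open>D\<close> is an admissible choice of the policy LL: \<open>m\<close> servers of smallest workload in \<open>S\<close>.
  The completion time of the last fragment does not depend on how ties are broken, and it is
  \<open>download_time\<close>.\<close>

definition least_loaded :: "(nat \<Rightarrow> real) \<Rightarrow> nat set \<Rightarrow> nat \<Rightarrow> nat set \<Rightarrow> bool" where
  "least_loaded u S m D \<longleftrightarrow> D \<subseteq> S \<and> card D = m \<and> (\<forall>a\<in>D. \<forall>b\<in>S - D. u a \<le> u b)"

lemma download_time_least_loaded:
  assumes "finite S" "1 \<le> k" "k \<le> card S" "least_loaded u S (min (card S) k) D"
  shows "Max ((\<lambda>s. u s + x) ` D) = download_time k u S x"
proof -
  have D: "D \<subseteq> S" "card D = k" and le: "\<And>a b. a \<in> D \<Longrightarrow> b \<in> S - D \<Longrightarrow> u a \<le> u b"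
    using assms unfolding least_loaded_def by auto
  have fin: "finite D" "finite (S - D)" and ne: "D \<noteq> {}"
    using D assms finite_subset by auto
  define p where "p = sorted_list_of_multiset (image_mset u (mset_set D))"
  define r where "r = sorted_list_of_multiset (image_mset u (mset_set (S - D)))"
  have sp: "set p = u ` D" and sr: "set r = u ` (S - D)"
    unfolding p_def r_def using fin by auto
  have lp: "length p = k"
    unfolding p_def using D fin by (metis size_mset mset_sorted_list_of_multiset size_image_mset size_mset_set)
  have st: "sorted p" "sorted r"
    unfolding p_def r_def by auto
  have "sorted (p @ r)"
    using st le sp sr by (auto simp: sorted_append)
  moreover have "mset (p @ r) = image_mset u (mset_set S)"
  proof -
    have "mset_set S = mset_set D + mset_set (S - D)"
      using mset_set_Union[of D "S - D"] fin D by (simp add: Un_absorb1)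
    then show ?thesis by (simp add: p_def r_def)
  qed
  ultimately have "sorted_list_of_multiset (image_mset u (mset_set S)) = p @ r"
    by (metis sorted_list_of_multiset_mset sorted_sort_id)
  then have os: "order_stat u S k = p ! (k - 1)"
    using lp assms by (simp add: order_stat_def nth_append)
  have in_p: "p ! (k - 1) \<in> u ` D"
    using lp assms sp nth_mem[of "k - 1" p] by auto
  have ub: "v \<le> p ! (k - 1)" if v: "v \<in> u ` D" for v
  proof -
    obtain i where "i < length p" "v = p ! i" using v sp by (metis in_set_conv_nth)
    then show ?thesis using st(1) lp assms by (auto intro!: sorted_nth_mono)
  qed
  have "Max ((\<lambda>s. u s + x) ` D) = p ! (k - 1) + x"
    using fin in_p ub by (intro Max_eqI) auto
  then show ?thesis by (simp add: download_time_def os)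
qed

end

theory Submission
  imports Defs
begin

text \<open>The \<open>k\<close>-th smallest of \<open>j\<close> workloads exceeds \<open>u\<close> iff fewer than \<open>k\<close> of them are at most \<open>u\<close>, a
  binomial event. Hence its law depends on a set of servers only through the number of servers, and
  since the set of available servers is independent of workloads, type and service time, it may be
  replaced by \<open>{..<j}\<close> once its cardinality \<open>j\<close> is known; summing over its values gives the law of
  total probability with binomial weights. The convolution formula is conditioning on the service
  time, using that the workloads are nonnegative (\<open>F = 0\<close> below 0) and that so are phase-type
  variables: at \<open>t = 0\<close> the tail \<open>\<alpha> exp(t S) 1\<close> equals 1. The mean is the layer-cake formula.\<close>

subsection \<open>Order statistics\<close>

text \<open>In a sorted list the indices of the entries at most \<open>a\<close> form an initial
  segment, so \<open>i\<close> belongs to it exactly when \<open>i\<close> is below its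
  length.\<close>

lemma nth_sorted_le_iff:
  fixes a :: "'a :: linorder"
  assumes "sorted xs" "i < length xs"
  shows "xs ! i \<le> a \<longleftrightarrow> i < length (filter (\<lambda>x. x \<le> a) xs)"
proof -
  define J where "J = {l. l < length xs \<and> xs ! l \<le> a}"
  have len: "length (filter (\<lambda>x. x \<le> a) xs) = card J"
    unfolding J_def by (rule length_filter_conv_card)
  have fin: "finite J" by (simp add: J_def)
  show ?thesis
  proof (cases "xs ! i \<le> a")
    case True
    then have "{..i} \<subseteq> J"
      using assms sorted_nth_mono[OF assms(1)] by (fastforce simp: J_def intro: order_trans)
    then show ?thesis using card_mono[OF fin, of "{..i}"] True len by simp
  next
    case False
    have "J \<subseteq> {..<i}"
    proof
      fix l assume "l \<in> J"
      then have l: "l < length xs" "xs ! l \<le> a" by (auto simp: J_def)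
      then have "\<not> i \<le> l"
        using False sorted_nth_mono[OF assms(1), of i l] by auto
      then show "l \<in> {..<i}" by simp
    qed
    then show ?thesis using card_mono[of "{..<i}" J] False len by simp
  qed
qed

text \<open>Counting form of the order statistic, through which its law becomes binomial. Ranks
  start at 1 and list indices at 0, so the strict bound on the index \<open>k - 1\<close> turns into
  a weak bound on \<open>k\<close>.\<close>

lemma order_stat_le_iff:
  assumes "finite S" "1 \<le> k" "k \<le> card S"
  shows "order_stat u S k \<le> a \<longleftrightarrow> k \<le> card {s\<in>S. u s \<le> a}"
proof -
  define xs where "xs = sorted_list_of_multiset (image_mset u (mset_set S))"
  have mset: "mset xs = image_mset u (mset_set S)" by (simp add: xs_def)
  have "length xs = card S"
    by (metis mset size_mset size_image_mset size_mset_set)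
  moreover have "length (filter (\<lambda>x. x \<le> a) xs) = card {s\<in>S. u s \<le> a}"
  proof -
    have "length (filter (\<lambda>x. x \<le> a) xs) = size (filter_mset (\<lambda>x. x \<le> a) (image_mset u (mset_set S)))"
      by (metis mset mset_filter size_mset)
    also have "\<dots> = card {s\<in>S. u s \<le> a}"
      using assms by (simp add: filter_mset_image_mset)
    finally show ?thesis .
  qed
  moreover have "sorted xs" by (simp add: xs_def)
  ultimately show ?thesis
    using nth_sorted_le_iff[of xs "k - 1" a] assms by (auto simp: order_stat_def xs_def)
qed

text \<open>Serves to remove \<open>restrict\<close> once the sources have been restricted to a
  block of indices containing \<open>S\<close>. For infinite \<open>S\<close> the multiset
  \<open>mset_set S\<close> is empty on both sides.\<close>

lemma order_stat_cong:
  assumes "\<And>s. s \<in> S \<Longrightarrow> u s = v s"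
  shows "order_stat u S k = order_stat v S k"
proof (cases "finite S")
  case True
  then have "image_mset u (mset_set S) = image_mset v (mset_set S)"
    using assms by (intro image_mset_cong) auto
  then show ?thesis by (simp add: order_stat_def)
qed (simp add: order_stat_def)

text \<open>By the counting form, the sublevel event is a finite union over the possible sets
  \<open>B\<close> of indices with value at most \<open>a\<close>. The space \<open>N\<close> is
  arbitrary because the lemma is applied both on \<open>M\<close> and on products of source
  spaces.\<close>

lemma borel_measurable_order_stat:
  assumes "finite S" "1 \<le> k" "k \<le> card S" "\<And>s. s \<in> S \<Longrightarrow> (\<lambda>\<omega>. u s \<omega>) \<in> borel_measurable N"
  shows "(\<lambda>\<omega>. order_stat (\<lambda>s. u s \<omega>) S k) \<in> borel_measurable N"
proof (subst borel_measurable_iff_le, intro allI)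
  fix a
  have "{\<omega> \<in> space N. {s\<in>S. u s \<omega> \<le> a} = B} \<in> sets N" if "B \<subseteq> S" for B
  proof -
    have "{\<omega> \<in> space N. {s\<in>S. u s \<omega> \<le> a} = B} = {\<omega> \<in> space N. \<forall>s\<in>S. u s \<omega> \<le> a \<longleftrightarrow> s \<in> B}"
      using that by auto
    also have "\<dots> \<in> sets N"
      using assms by measurable
    finally show ?thesis .
  qed
  then have "(\<Union>B\<in>{B. B \<subseteq> S \<and> k \<le> card B}. {\<omega> \<in> space N. {s\<in>S. u s \<omega> \<le> a} = B}) \<in> sets N"
    using assms by (intro sets.finite_UN) auto
  also have "(\<Union>B\<in>{B. B \<subseteq> S \<and> k \<le> card B}. {\<omega> \<in> space N. {s\<in>S. u s \<omega> \<le> a} = B}) =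
      {\<omega> \<in> space N. order_stat (\<lambda>s. u s \<omega>) S k \<le> a}"
    using order_stat_le_iff[OF assms(1-3)] by auto
  finally show "{\<omega> \<in> space N. order_stat (\<lambda>s. u s \<omega>) S k \<le> a} \<in> sets N" .
qed

subsection \<open>Phase-type laws\<close>

text \<open>Only the term of order 0 of the exponential series survives, since the zeroth power of
  the zero matrix is the identity.\<close>

lemma mat_exp_zero:
  assumes "S \<in> carrier_mat n n"
  shows "mat_exp (0 \<cdot>\<^sub>m S) = 1\<^sub>m n"
proof -
  have Z: "0 \<cdot>\<^sub>m S = 0\<^sub>m n n" using assms by (intro eq_matI) auto
  have pow: "(0\<^sub>m n n :: real mat) ^\<^sub>m m = (if m = 0 then 1\<^sub>m n else 0\<^sub>m n n)" for m
    by (cases m) auto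
  have "(\<Sum>m. ((0\<^sub>m n n :: real mat) ^\<^sub>m m) $$ (i, j) / fact m) = 1\<^sub>m n $$ (i, j)"
    if "i < n" "j < n" for i j
    using that by (subst suminf_finite[of "{0}"]) (auto simp: pow)
  then show ?thesis unfolding Z mat_exp_def by (intro eq_matI) auto
qed

text \<open>At \<open>t = 0\<close> the tail formula reads off the total initial mass of
  \<open>\<alpha>\<close>, which is 1.\<close>

lemma phase_type_positive:
  assumes "phase_type \<mu>"
  shows "measure \<mu> {0<..} = 1"
proof -
  obtain n \<alpha> S where \<alpha>: "\<alpha> \<in> carrier_vec n" "(\<Sum>i<n. vec_index \<alpha> i) = 1"
    and S: "S \<in> carrier_mat n n"
    and tail: "\<forall>t\<ge>0. measure \<mu> {t<..} =
      scalar_prod \<alpha> (mat_exp (smult_mat t S) *\<^sub>v vec n (\<lambda>_. 1))"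
    using assms unfolding phase_type_def sub_generator_def by blast
  have "measure \<mu> {0<..} = scalar_prod \<alpha> (1\<^sub>m n *\<^sub>v vec n (\<lambda>_. 1))"
    using tail mat_exp_zero[OF S] by simp
  also have "\<dots> = 1"
    using \<alpha> by (simp add: scalar_prod_def atLeast0LessThan)
  finally show ?thesis .
qed

subsection \<open>Tail integrals, binomial counts and convolution\<close>

text \<open>Fubini for the indicator of the region between 0 and the graph of \<open>f\<close>: the
  section at \<open>x\<close> has length \<open>f x\<close>, the section at \<open>w\<close> is a
  tail event. Where \<open>f x\<close> is negative the section is empty and
  \<open>ennreal (f x)\<close> is 0.\<close>

lemma (in sigma_finite_measure) nn_integral_tail:
  fixes f :: "'a \<Rightarrow> real"
  assumes [measurable]: "f \<in> borel_measurable M"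
  shows "(\<integral>\<^sup>+x. ennreal (f x) \<partial>M) = (\<integral>\<^sup>+w\<in>{0..}. emeasure M {x\<in>space M. f x > w} \<partial>lborel)"
proof -
  interpret P: pair_sigma_finite M lborel ..
  define h where "h x w = (indicator {y. 0 \<le> snd y \<and> snd y < f (fst y)} (x, w) :: ennreal)" for x w
  have h[measurable]: "case_prod h \<in> borel_measurable (M \<Otimes>\<^sub>M lborel)"
    unfolding h_def by measurable
  have "(\<integral>\<^sup>+w. h x w \<partial>lborel) = ennreal (f x)" for x
  proof -
    have "(\<integral>\<^sup>+w. h x w \<partial>lborel) = (\<integral>\<^sup>+w. indicator {0..<f x} w \<partial>lborel)"
      by (intro nn_integral_cong) (auto simp: h_def indicator_def)
    also have "\<dots> = ennreal (f x)"
      by (cases "0 \<le> f x") (auto simp: ennreal_neg)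
    finally show ?thesis .
  qed
  moreover have "(\<integral>\<^sup>+x. h x w \<partial>M) = emeasure M {x\<in>space M. f x > w} * indicator {0..} w" for w
  proof -
    have "(\<integral>\<^sup>+x. h x w \<partial>M) = (\<integral>\<^sup>+x. indicator {0..} w * indicator {x\<in>space M. f x > w} x \<partial>M)"
      by (intro nn_integral_cong) (auto simp: h_def indicator_def)
    also have "\<dots> = emeasure M {x\<in>space M. f x > w} * indicator {0..} w"
      by (subst nn_integral_cmult) (auto simp: mult.commute)
    finally show ?thesis .
  qed
  ultimately show ?thesis using P.Fubini'[OF h] by simp
qed

section \<open>Independent hits, tails of sums, conditional tails and independent blocks\<close>

context prob_space
begin

text \<open>The hit set is \<open>B\<close> exactly when each index in \<open>B\<close> hits and
  each other index of \<open>S\<close> misses; independence multiplies the probabilities of these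
  events.\<close>

lemma prob_hits_eq:
  assumes ind: "indep_vars (\<lambda>_. N) Z S" and S: "finite S" and E: "E \<in> sets N"
    and a: "\<And>s. s \<in> S \<Longrightarrow> \<P>(\<omega> in M. Z s \<omega> \<in> E) = a" and B: "B \<subseteq> S"
  shows "\<P>(\<omega> in M. {s\<in>S. Z s \<omega> \<in> E} = B) = a ^ card B * (1 - a) ^ (card S - card B)"
\<comment> \<open>The empty index set is separate because an empty intersection is the universe and
  not \<open>space M\<close>.\<close>
proof (cases "S = {}")
  case True
  then show ?thesis using B by (simp add: prob_space)
next
  case False
  define C where "C s = (if s \<in> B then E else space N - E)" for s
  have rv: "random_variable N (Z s)" if "s \<in> S" for s
    using ind that by (simp add: indep_vars_def)
  have ev: "Z s -` E \<inter> space M \<in> events" if "s \<in> S" for s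
    using rv[OF that] E by (rule measurable_sets)
  have pE: "prob (Z s -` E \<inter> space M) = a" if "s \<in> S" for s
    using a[OF that] by (simp add: vimage_def Int_def conj_commute)
  have pC: "prob (Z s -` C s \<inter> space M) = (if s \<in> B then a else 1 - a)" if "s \<in> S" for s
  proof (cases "s \<in> B")
    case False
    have "Z s -` C s \<inter> space M = space M - (Z s -` E \<inter> space M)"
      using measurable_space[OF rv[OF that]] False by (auto simp: C_def)
    then show ?thesis using prob_compl[OF ev[OF that]] pE[OF that] False by simp
  qed (use pE that in \<open>simp add: C_def\<close>)
  have "{\<omega> \<in> space M. {s\<in>S. Z s \<omega> \<in> E} = B} = (\<Inter>s\<in>S. Z s -` C s \<inter> space M)"
    using measurable_space[OF rv] False B by (auto simp: C_def split: if_splits)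
  also have "prob \<dots> = (\<Prod>s\<in>S. prob (Z s -` C s \<inter> space M))"
    using E S False by (intro indep_varsD_finite[OF ind]) (auto simp: C_def)
  also have "\<dots> = (\<Prod>s\<in>S. if s \<in> B then a else 1 - a)"
    by (intro prod.cong) (auto simp: pC)
  also have "\<dots> = a ^ card B * (1 - a) ^ (card S - card B)"
    using S B by (simp add: prod.If_cases Int_absorb1 card_Diff_subset finite_subset Diff_eq[symmetric])
  finally show ?thesis .
qed

text \<open>All hit sets of size \<open>m\<close> are equally likely, and a binomial coefficient
  counts them. It is used for the availabilities with \<open>E = {1}\<close> and for the workloads
  with a half-line.\<close>

lemma prob_hits_card:
  assumes "indep_vars (\<lambda>_. N) Z S" "finite S" "E \<in> sets N"
    and "\<And>s. s \<in> S \<Longrightarrow> \<P>(\<omega> in M. Z s \<omega> \<in> E) = a"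
  shows "\<P>(\<omega> in M. card {s\<in>S. Z s \<omega> \<in> E} = m)
    = real (card S choose m) * a ^ m * (1 - a) ^ (card S - m)"
proof -
  have rv: "random_variable N (Z s)" if "s \<in> S" for s
    using assms that by (simp add: indep_vars_def)
  have "{\<omega> \<in> space M. {s\<in>S. Z s \<omega> \<in> E} = B} \<in> events" if "B \<subseteq> S" for B
  proof -
    have "{\<omega> \<in> space M. {s\<in>S. Z s \<omega> \<in> E} = B} = {\<omega> \<in> space M. \<forall>s\<in>S. Z s \<omega> \<in> E \<longleftrightarrow> s \<in> B}"
      using that by auto
    also have "\<dots> \<in> events"
      using assms(2,3) rv by measurable
    finally show ?thesis .
  qed
  then have "prob (\<Union>B\<in>{B. B \<subseteq> S \<and> card B = m}. {\<omega> \<in> space M. {s\<in>S. Z s \<omega> \<in> E} = B})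
    = (\<Sum>B\<in>{B. B \<subseteq> S \<and> card B = m}. \<P>(\<omega> in M. {s\<in>S. Z s \<omega> \<in> E} = B))"
    using assms(2) by (intro finite_measure_finite_Union) (auto simp: disjoint_family_on_def)
  also have "\<dots> = (\<Sum>B\<in>{B. B \<subseteq> S \<and> card B = m}. a ^ m * (1 - a) ^ (card S - m))"
    using prob_hits_eq[OF assms] by (intro sum.cong) auto
  also have "(\<Union>B\<in>{B. B \<subseteq> S \<and> card B = m}. {\<omega> \<in> space M. {s\<in>S. Z s \<omega> \<in> E} = B})
    = {\<omega> \<in> space M. card {s\<in>S. Z s \<omega> \<in> E} = m}"
    by auto
  finally show ?thesis using n_subsets[OF assms(2)] by simp
qed

lemma prob_order_stat_gt:
  assumes ind: "indep_vars (\<lambda>_. borel) Z S" and S: "finite S" "1 \<le> k" "k \<le> card S"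
    and F: "\<And>s. s \<in> S \<Longrightarrow> \<P>(\<omega> in M. Z s \<omega> \<le> u) = F"
  shows "\<P>(\<omega> in M. order_stat (\<lambda>s. Z s \<omega>) S k > u)
    = (\<Sum>m=0..k - 1. real (card S choose m) * (1 - F) ^ (card S - m) * F ^ m)"
proof -
  have [measurable]: "random_variable borel (Z s)" if "s \<in> S" for s
    using ind that by (simp add: indep_vars_def)
  let ?E = "\<lambda>m. {\<omega> \<in> space M. card {s\<in>S. Z s \<omega> \<in> {..u}} = m}"
  \<comment> \<open>By \<open>1 \<le> k\<close>, having fewer than \<open>k\<close> hits of the
    half-line \<open>{..u}\<close> means that their number lies in
    \<open>{0..k - 1}\<close>.\<close>
  have "{\<omega> \<in> space M. order_stat (\<lambda>s. Z s \<omega>) S k > u} = (\<Union>m\<in>{0..k - 1}. ?E m)"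
    using order_stat_le_iff[OF S] S(2) by (auto simp: not_le[symmetric])
  moreover have "?E m \<in> events" for m
    using S(1) by measurable
  ultimately have "\<P>(\<omega> in M. order_stat (\<lambda>s. Z s \<omega>) S k > u) = (\<Sum>m=0..k - 1. prob (?E m))"
    by (auto intro!: finite_measure_finite_Union simp: disjoint_family_on_def)
  then show ?thesis
    using prob_hits_card[OF ind S(1), of "{..u}" F] F by (simp add: mult_ac)
qed

text \<open>Conditioning on \<open>X = x\<close> leaves the tail of \<open>V\<close> at
  \<open>w - x\<close>. For \<open>x > w\<close> this tail is 1 and contributes the tail of
  \<open>X\<close>; for \<open>0 \<le> x \<le> w\<close> it contributes the convolution integral;
  negative \<open>x\<close> carry no mass.\<close>

lemma prob_add_density_gt:
  fixes V X :: "'a \<Rightarrow> real" and g :: "real \<Rightarrow> real"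
  assumes ind: "indep_var borel V borel X"
    and V: "\<And>v. v < 0 \<Longrightarrow> \<P>(\<omega> in M. V \<omega> > v) = 1"
    and X: "\<P>(\<omega> in M. X \<omega> < 0) = 0" "distributed M lborel X (\<lambda>x. ennreal (g x))" "\<And>x. 0 \<le> g x"
  shows "\<P>(\<omega> in M. V \<omega> + X \<omega> > w) =
    \<P>(\<omega> in M. X \<omega> > w) + (LBINT u:{0..w}. \<P>(\<omega> in M. V \<omega> > u) * g (w - u))"
proof -
  have [measurable]: "random_variable borel V" "random_variable borel X"
    using indep_var_rv1[OF ind] indep_var_rv2[OF ind] .
  \<comment> \<open>\<open>distributed\<close> gives measurability of \<open>ennreal (g x)\<close>;
    since \<open>g\<close> is nonnegative, \<open>enn2real\<close> recovers
    \<open>g\<close>.\<close>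
  have "(\<lambda>x. enn2real (ennreal (g x))) \<in> borel_measurable borel"
    using distributed_borel_measurable[OF X(2)] by simp
  then have g[measurable]: "g \<in> borel_measurable borel" using X(3) by simp
  define H where "H v = \<P>(\<omega> in M. V \<omega> > v)" for v
  \<comment> \<open>The tail \<open>H\<close> is antitone, and monotone real functions are Borel
    measurable.\<close>
  have "mono (\<lambda>v. - H v)"
    unfolding H_def by (intro monoI le_imp_neg_le finite_measure_mono) auto
  then have "(\<lambda>v. - (- H v)) \<in> borel_measurable borel"
    by (intro borel_measurable_uminus borel_measurable_mono)
  then have [measurable]: "H \<in> borel_measurable borel" by simp
  have H0: "0 \<le> H v" for v by (simp add: H_def)
  have distrX: "distr M borel X = density lborel (\<lambda>x. ennreal (g x))"
    using distributed_distr_eq_density[OF X(2)] distr_cong[of M M borel lborel X X] by simp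
  have nnX: "(\<integral>\<^sup>+x. ennreal (g x) * indicator B x \<partial>lborel) = ennreal (\<P>(\<omega> in M. X \<omega> \<in> B))"
    if "B \<in> sets borel" for B
    using distributed_emeasure[OF X(2), of B] that
    by (simp add: emeasure_eq_measure vimage_def Int_def conj_commute)
  \<comment> \<open>A density is determined only up to null sets, so nonnegativity of
    \<open>X\<close> makes \<open>g\<close> vanish only almost everywhere on the negative
    axis.\<close>
  have "(\<integral>\<^sup>+x. ennreal (g x) * indicator {..<0} x \<partial>lborel) = 0"
    using nnX[of "{..<0}"] X(1) by simp
  then have neg: "AE x in lborel. ennreal (g x) * indicator {..<0} x = 0"
    by (subst (asm) nn_integral_0_iff_AE) auto

  have tail: "ennreal (\<P>(\<omega> in M. V \<omega> + X \<omega> > w)) = (\<integral>\<^sup>+x. ennreal (g x) * ennreal (H (w - x)) \<partial>lborel)"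
  proof -
    interpret DV: prob_space "distr M borel V" by (rule prob_space_distr) simp
    interpret DX: prob_space "distr M borel X" by (rule prob_space_distr) simp
    have "ennreal (\<P>(\<omega> in M. V \<omega> + X \<omega> > w)) = emeasure (distr M borel (\<lambda>\<omega>. V \<omega> + X \<omega>)) {w<..}"
      by (subst emeasure_distr) (auto simp: emeasure_eq_measure vimage_def Int_def conj_commute)
    also have "\<dots> = emeasure (distr M borel X \<star> distr M borel V) {w<..}"
      using DV.finite_measure_axioms DX.finite_measure_axioms
      by (subst sum_indep_random_variable[OF ind], simp, simp, subst convolution_commutative) simp_all
    also have "\<dots> = (\<integral>\<^sup>+x. emeasure (distr M borel V) {a. a + x \<in> {w<..}} \<partial>distr M borel X)"
      using DV.finite_measure_axioms DX.finite_measure_axioms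
      by (subst convolution_emeasure) auto
    also have "\<dots> = (\<integral>\<^sup>+x. ennreal (H (w - x)) \<partial>distr M borel X)"
    proof (intro nn_integral_cong)
      fix x
      have "{a. a + x \<in> {w<..}} = {w - x<..}" by auto
      then show "emeasure (distr M borel V) {a. a + x \<in> {w<..}} = ennreal (H (w - x))"
        by (simp add: emeasure_distr emeasure_eq_measure vimage_def Int_def conj_commute H_def)
    qed
    also have "\<dots> = (\<integral>\<^sup>+x. ennreal (g x) * ennreal (H (w - x)) \<partial>lborel)"
      unfolding distrX by (subst nn_integral_density) auto
    finally show ?thesis .
  qed
  define I where "I = (\<integral>\<^sup>+u. ennreal (indicator {0..w} u * (H u * g (w - u))) \<partial>lborel)"
  have "(\<integral>\<^sup>+x. ennreal (g x) * ennreal (H (w - x)) \<partial>lborel) =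
    (\<integral>\<^sup>+x. ennreal (g x) * indicator {w<..} x + ennreal (indicator {0..w} (w - x) * (H (w - x) * g x)) \<partial>lborel)"
    using neg
  proof (intro nn_integral_cong_AE, eventually_elim)
    case (elim x)
    show ?case
    proof (cases "x > w")
      case True
      then have "H (w - x) = 1" using V by (simp add: H_def)
      then show ?thesis using True by simp
    next
      case False
      show ?thesis
      proof (cases "x < 0")
        case True
        then show ?thesis using elim X(3)[of x] False by (simp add: indicator_def)
      qed (use False H0 X(3) in \<open>simp add: ennreal_mult' mult.commute\<close>)
    qed
  qed
  also have "\<dots> = ennreal (\<P>(\<omega> in M. X \<omega> > w)) +
      (\<integral>\<^sup>+x. ennreal (indicator {0..w} (w - x) * (H (w - x) * g x)) \<partial>lborel)"
    using nnX[of "{w<..}"] by (subst nn_integral_add) auto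
  \<comment> \<open>The substitution \<open>u = w - x\<close>, whose Jacobian has absolute value
    1.\<close>
  also have "(\<integral>\<^sup>+x. ennreal (indicator {0..w} (w - x) * (H (w - x) * g x)) \<partial>lborel) = I"
    unfolding I_def by (subst nn_integral_real_affine[of _ "-1" w]) auto
  finally have eq: "ennreal (\<P>(\<omega> in M. V \<omega> + X \<omega> > w)) = ennreal (\<P>(\<omega> in M. X \<omega> > w)) + I"
    using tail by simp
  have "(LBINT u:{0..w}. H u * g (w - u)) = enn2real I"
    unfolding set_lebesgue_integral_def I_def
    using H0 X(3) by (subst integral_eq_nn_integral) auto
  \<comment> \<open>Finiteness of \<open>I\<close>, which is bounded by a probability, makes
    \<open>enn2real\<close> additive on the sum.\<close>
  moreover have "I < \<top>"
  proof -
    have "I \<le> ennreal (\<P>(\<omega> in M. V \<omega> + X \<omega> > w))" unfolding eq by simp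
    then show ?thesis by (rule le_less_trans) simp
  qed
  then have "enn2real (ennreal (\<P>(\<omega> in M. X \<omega> > w)) + I) = \<P>(\<omega> in M. X \<omega> > w) + enn2real I"
    by (subst enn2real_plus) auto
  ultimately show ?thesis
    using arg_cong[OF eq, of enn2real] by (simp add: H_def)
qed

text \<open>\<open>uniform_measure\<close> on an event of positive probability is the conditional
  law, so its tails are conditional probabilities and the layer-cake formula applies to it.\<close>

lemma nn_integral_uniform_measure_tail:
  fixes f :: "'a \<Rightarrow> real"
  assumes [measurable]: "f \<in> borel_measurable M" "{\<omega> \<in> space M. Q \<omega>} \<in> events"
    and pos: "\<P>(\<omega> in M. Q \<omega>) > 0"
  shows "(\<integral>\<^sup>+\<omega>. ennreal (f \<omega>) \<partial>uniform_measure M {\<omega> \<in> space M. Q \<omega>}) =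
    (\<integral>\<^sup>+w\<in>{0..}. ennreal (\<P>(\<omega> in M. f \<omega> > w \<bar> Q \<omega>)) \<partial>lborel)"
proof -
  let ?N = "uniform_measure M {\<omega> \<in> space M. Q \<omega>}"
  interpret N: prob_space ?N
    using pos by (intro prob_space_uniform_measure) (auto simp: emeasure_eq_measure)
  have "emeasure ?N {\<omega> \<in> space ?N. f \<omega> > w} = ennreal (\<P>(\<omega> in M. f \<omega> > w \<bar> Q \<omega>))" for w
    using measure_uniform_measure_eq_cond_prob[of "\<lambda>\<omega>. f \<omega> > w" Q] N.emeasure_eq_measure
    by simp
  then show ?thesis using N.nn_integral_tail[of f] by simp
qed

text \<open>Functions of disjoint blocks of independent variables are independent. The
  \<open>restrict\<close> makes each block an element of the product space on which
  \<open>Y j\<close> is defined.\<close>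

lemma indep_vars_blocks:
  assumes "indep_vars M' X I" "\<And>j. j \<in> L \<Longrightarrow> K j \<subseteq> I" "disjoint_family_on K L"
    and "\<And>j. j \<in> L \<Longrightarrow> Y j \<in> measurable (PiM (K j) M') (N j)"
  shows "indep_vars N (\<lambda>j \<omega>. Y j (restrict (\<lambda>i. X i \<omega>) (K j))) L"
  using indep_vars_compose2[OF indep_vars_restrict[OF assms(1-3)] assms(4)] .

text \<open>Each new index \<open>j\<close> gets the singleton block \<open>{h j}\<close>;
  injectivity of \<open>h\<close> makes the blocks disjoint.\<close>

lemma indep_vars_reindex:
  assumes ind: "indep_vars M' X (h ` J)" and inj: "inj_on h J"
  shows "indep_vars (\<lambda>j. M' (h j)) (\<lambda>j. X (h j)) J"
proof -
  have "indep_vars (\<lambda>j. M' (h j)) (\<lambda>j \<omega>. (restrict (\<lambda>i. X i \<omega>) {h j}) (h j)) J"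
    using inj by (intro indep_vars_blocks[OF ind, of J "\<lambda>j. {h j}" "\<lambda>j f. f (h j)"])
      (auto simp: disjoint_family_on_def inj_on_def)
  then show ?thesis by simp
qed

end

subsection \<open>A request in the mean field limit\<close>

lemma finite_UNIV_req_type: "finite (UNIV :: req_type set)"
  by (rule finite_subset[of _ "{Hot, Cold}"]) (auto intro: req_type.exhaust)

text \<open>Coding the type as a real loses nothing, so every event about the type is an event about
  its code.\<close>

lemma inj_of_bool_eq_Hot: "inj (\<lambda>t. of_bool (t = Hot) :: real)"
proof (rule injI)
  show "t = t'" if "of_bool (t = Hot) = (of_bool (t' = Hot) :: real)" for t t'
    using that by (cases t; cases t') auto
qed

text \<open>A single family of \<open>D\<close> potential servers covers both request types: a type
  selecting \<open>d \<le> D\<close> servers uses the first \<open>d\<close> of them.\<close>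

locale storage_request = prob_space M for M :: "'a measure" +
  fixes T :: "'a \<Rightarrow> req_type" and A :: "nat \<Rightarrow> 'a \<Rightarrow> bool" and U :: "nat \<Rightarrow> 'a \<Rightarrow> real"
    and X :: "req_type \<Rightarrow> 'a \<Rightarrow> real" and D :: nat and q :: real and F :: "real \<Rightarrow> real"
  assumes indep: "indep_vars (\<lambda>_. borel) (source_var T A U X)
      ({RType} \<union> Avail ` {..<D} \<union> Load ` {..<D} \<union> range Service)"
    and prob_A: "\<And>s. s < D \<Longrightarrow> \<P>(\<omega> in M. A s \<omega>) = q"
    and cdf_U: "\<And>s. s < D \<Longrightarrow> cdf (distr M borel (U s)) = F"
begin

lemma measurable_sources [measurable]:
  shows "{\<omega> \<in> space M. Q (T \<omega>)} \<in> events"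
    and "s < D \<Longrightarrow> {\<omega> \<in> space M. A s \<omega>} \<in> events"
    and "s < D \<Longrightarrow> random_variable borel (U s)"
    and "random_variable borel (X i)"
proof -
  have rv: "random_variable borel (source_var T A U X a)"
    if "a \<in> {RType} \<union> Avail ` {..<D} \<union> Load ` {..<D} \<union> range Service" for a
    using indep that unfolding indep_vars_def by blast
  show "random_variable borel (U s)" if "s < D" using rv[of "Load s"] that by simp
  show "random_variable borel (X i)" using rv[of "Service i"] by simp
  have [measurable]: "random_variable borel (\<lambda>\<omega>. of_bool (T \<omega> = Hot) :: real)"
    using rv[of RType] by simp
  \<comment> \<open>There are only two types, so an arbitrary predicate \<open>Q\<close> is decided
    by its values at \<open>Hot\<close> and \<open>Cold\<close>.\<close>
  have "{\<omega> \<in> space M. Q (T \<omega>)} = {\<omega> \<in> space M.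
      (of_bool (T \<omega> = Hot) = (1::real) \<and> Q Hot) \<or> (of_bool (T \<omega> = Hot) = (0::real) \<and> Q Cold)}"
    by (auto, (metis req_type.exhaust)+)
  also have "\<dots> \<in> events" by measurable
  finally show "{\<omega> \<in> space M. Q (T \<omega>)} \<in> events" .
  show "{\<omega> \<in> space M. A s \<omega>} \<in> events" if "s < D"
  proof -
    have [measurable]: "random_variable borel (\<lambda>\<omega>. of_bool (A s \<omega>) :: real)"
      using rv[of "Avail s"] that by simp
    have "{\<omega> \<in> space M. A s \<omega>} = {\<omega> \<in> space M. of_bool (A s \<omega>) = (1::real)}" by simp
    also have "\<dots> \<in> events" by measurable
    finally show ?thesis .
  qed
qed

section \<open>Availabilities, order statistics and download times on fixed sets of servers\<close>

lemma indep_vars_U: "S \<subseteq> {..<D} \<Longrightarrow> indep_vars (\<lambda>_. borel) U S"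
  using indep_vars_reindex[OF indep_vars_subset[OF indep, of "Load ` S"]]
  by (auto simp: inj_on_def)

lemma indep_vars_A: "S \<subseteq> {..<D} \<Longrightarrow> indep_vars (\<lambda>_. borel) (\<lambda>s \<omega>. of_bool (A s \<omega>) :: real) S"
  using indep_vars_reindex[OF indep_vars_subset[OF indep, of "Avail ` S"]]
  by (auto simp: inj_on_def)

text \<open>Presents the available servers as the hit set of \<open>{1}\<close> for the coded
  availabilities, the shape that \<open>prob_hits_card\<close> expects.\<close>

lemma available_alt: "available A d \<omega> = {s\<in>{..<d}. of_bool (A s \<omega>) \<in> {1::real}}"
  by (auto simp: available_def)

lemma prob_available_card:
  assumes "d \<le> D"
  shows "\<P>(\<omega> in M. card (available A d \<omega>) = j) = avail_prob q d j"
  unfolding available_alt avail_prob_def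
  using assms by (subst prob_hits_card[OF indep_vars_A]) (auto simp: prob_A)

lemma prob_U_le: "s < D \<Longrightarrow> \<P>(\<omega> in M. U s \<omega> \<le> u) = F u"
  using cdf_U[of s] by (auto simp: cdf_def measure_distr vimage_def Int_def conj_commute)

lemma prob_order_stat_U_gt:
  assumes "S \<subseteq> {..<D}" "1 \<le> k" "k \<le> card S"
  shows "\<P>(\<omega> in M. order_stat (\<lambda>s. U s \<omega>) S k > u) =
    (\<Sum>m=0..k - 1. real (card S choose m) * (1 - F u) ^ (card S - m) * F u ^ m)"
  using assms by (intro prob_order_stat_gt indep_vars_U) (auto intro: finite_subset simp: prob_U_le)

lemma random_variable_order_stat_U [measurable (raw)]:
  assumes "S \<subseteq> {..<D}" "1 \<le> k" "k \<le> card S"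
  shows "random_variable borel (\<lambda>\<omega>. order_stat (\<lambda>s. U s \<omega>) S k)"
  using assms by (intro borel_measurable_order_stat) (auto intro: finite_subset)

text \<open>The order statistic as a function of the sources themselves. The index set
  \<open>K\<close> may be larger than the loads, since one block below also contains the service
  time.\<close>

lemma measurable_order_stat_Load:
  assumes "S \<subseteq> {..<D}" "1 \<le> k" "k \<le> card S" "Load ` S \<subseteq> K"
  shows "(\<lambda>f. order_stat (\<lambda>s. f (Load s)) S k) \<in> borel_measurable (PiM K (\<lambda>_. borel))"
  using assms by (intro borel_measurable_order_stat)
    (auto intro: finite_subset intro!: measurable_component_singleton)

lemma indep_var_order_stat_service:
  assumes S: "S \<subseteq> {..<D}" "1 \<le> k" "k \<le> card S"
  shows "indep_var borel (\<lambda>\<omega>. order_stat (\<lambda>s. U s \<omega>) S k) borel (X i)"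
proof -
  have "indep_var
      borel ((\<lambda>f. order_stat (\<lambda>s. f (Load s)) S k) \<circ>
        (\<lambda>\<omega>. restrict (\<lambda>a. source_var T A U X a \<omega>) (Load ` S)))
      borel ((\<lambda>f. f (Service i)) \<circ>
        (\<lambda>\<omega>. restrict (\<lambda>a. source_var T A U X a \<omega>) {Service i}))"
    using S by (intro indep_var_compose[OF indep_var_restrict[OF indep]]
      measurable_order_stat_Load measurable_component_singleton) auto
  moreover have "order_stat (\<lambda>s. restrict (\<lambda>a. source_var T A U X a \<omega>) (Load ` S) (Load s)) S k
      = order_stat (\<lambda>s. U s \<omega>) S k" for \<omega>
    by (intro order_stat_cong) auto
  ultimately show ?thesis by (simp add: comp_def)
qed

lemma random_variable_download_time:
  assumes "S \<subseteq> {..<D}" "1 \<le> k" "k \<le> card S"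
  shows "random_variable borel (\<lambda>\<omega>. download_time k (\<lambda>s. U s \<omega>) S (X i \<omega>))"
  using random_variable_order_stat_U[OF assms] by (simp add: download_time_def)

text \<open>By exchangeability of the workloads, only the number of servers in \<open>S\<close> matters.\<close>

lemma distr_download_time_cong:
  assumes S: "S \<subseteq> {..<D}" "S' \<subseteq> {..<D}" "1 \<le> k" "k \<le> card S" "card S = card S'"
  shows "distr M borel (\<lambda>\<omega>. download_time k (\<lambda>s. U s \<omega>) S (X i \<omega>)) =
    distr M borel (\<lambda>\<omega>. download_time k (\<lambda>s. U s \<omega>) S' (X i \<omega>))"
proof -
  let ?V = "\<lambda>S \<omega>. order_stat (\<lambda>s. U s \<omega>) S k"
  have rv: "random_variable borel (?V S)" "random_variable borel (?V S')"
    using S by (auto intro: random_variable_order_stat_U)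
  have cdf: "cdf (distr M borel (?V B)) u = 1 - \<P>(\<omega> in M. ?V B \<omega> > u)"
    if [measurable]: "random_variable borel (?V B)" for B u
  proof -
    have "cdf (distr M borel (?V B)) u = \<P>(\<omega> in M. \<not> ?V B \<omega> > u)"
      by (auto simp: cdf_def measure_distr vimage_def Int_def conj_commute not_less)
    also have "\<dots> = 1 - \<P>(\<omega> in M. ?V B \<omega> > u)"
      by (intro prob_neg) measurable
    finally show ?thesis .
  qed
  \<comment> \<open>A real law is determined by its CDF, and the binomial tail involves the set of
    servers only through its cardinality.\<close>
  have "distr M borel (?V S) = distr M borel (?V S')"
    using S rv by (intro cdf_unique real_distribution_distr) (auto simp: fun_eq_iff cdf prob_order_stat_U_gt)
  \<comment> \<open>Independence of the service time makes each download-time law a convolution of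
    the order statistic law with the same service law.\<close>
  then show ?thesis
    using S rv indep_var_order_stat_service
    by (simp add: download_time_def sum_indep_random_variable)
qed

text \<open>The download time here is taken over a fixed set \<open>S\<close>, so the three
  conditions concern disjoint blocks of sources. Later \<open>S\<close> is chosen equal to
  \<open>B\<close>.\<close>

lemma prob_type_available_download_time:
  assumes d: "d \<le> D" and S: "S \<subseteq> {..<D}" "1 \<le> k" "k \<le> card S" and E: "E \<in> sets borel"
  shows "\<P>(\<omega> in M. Q (T \<omega>) \<and> available A d \<omega> = B \<and>
      download_time k (\<lambda>s. U s \<omega>) S (X i \<omega>) \<in> E) =
    \<P>(\<omega> in M. Q (T \<omega>)) * \<P>(\<omega> in M. available A d \<omega> = B) *
      \<P>(\<omega> in M. download_time k (\<lambda>s. U s \<omega>) S (X i \<omega>) \<in> E)"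
proof -
  \<comment> \<open>Blocks 0, 1, 2 of the sources: the type; the availabilities; the loads of \<open>S\<close> with the
    service time.\<close>
  define K :: "nat \<Rightarrow> source set" where
    "K = (\<lambda>_. {}) (0 := {RType}, 1 := Avail ` {..<d}, 2 := insert (Service i) (Load ` S))"
  define Y :: "nat \<Rightarrow> (source \<Rightarrow> real) \<Rightarrow> real" where
    "Y = (\<lambda>_ _. 0) (0 := \<lambda>f. f RType, 1 := \<lambda>f. of_bool ({s\<in>{..<d}. f (Avail s) = 1} = B),
      2 := \<lambda>f. order_stat (\<lambda>s. f (Load s)) S k + f (Service i))"
  define C :: "nat \<Rightarrow> real set" where
    "C = (\<lambda>_. {}) (0 := (\<lambda>t. of_bool (t = Hot)) ` {t. Q t}, 1 := {1}, 2 := E)"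
  define Z where "Z j \<omega> = Y j (restrict (\<lambda>a. source_var T A U X a \<omega>) (K j))" for j \<omega>
  have meas: "Y j \<in> borel_measurable (PiM (K j) (\<lambda>_. borel))" if "j \<in> {0, 1, 2}" for j
  proof -
    have "Y 0 \<in> borel_measurable (PiM (K 0) (\<lambda>_. borel))"
      unfolding Y_def K_def by simp
    moreover have "Y 1 \<in> borel_measurable (PiM (K 1) (\<lambda>_. borel))"
    proof -
      let ?N = "PiM (K 1) (\<lambda>_. borel) :: (source \<Rightarrow> real) measure"
      have [measurable]: "(\<lambda>f. f (Avail s)) \<in> borel_measurable ?N" if "s < d" for s
        using that by (intro measurable_component_singleton) (auto simp: K_def)
      \<comment> \<open>Equality with \<open>B\<close> becomes finitely many conditions on
        coordinates, plus a constant one that makes the event empty unless \<open>B\<close> is a set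
        of selected servers.\<close>
      have "Measurable.pred ?N (\<lambda>f. B \<subseteq> {..<d} \<and> (\<forall>s\<in>{..<d}. f (Avail s) = 1 \<longleftrightarrow> s \<in> B))"
        by measurable
      also have "(\<lambda>f. B \<subseteq> {..<d} \<and> (\<forall>s\<in>{..<d}. f (Avail s) = 1 \<longleftrightarrow> s \<in> B)) =
          (\<lambda>f :: source \<Rightarrow> real. {s\<in>{..<d}. f (Avail s) = 1} = B)"
        by (auto simp: fun_eq_iff)
      finally have [measurable]: "Measurable.pred ?N (\<lambda>f. {s\<in>{..<d}. f (Avail s) = 1} = B)" .
      have "(\<lambda>f. of_bool ({s\<in>{..<d}. f (Avail s) = 1} = B) :: real) \<in> borel_measurable ?N"
        unfolding of_bool_def by measurable
      then show ?thesis by (simp add: Y_def)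
    qed
    moreover have "Y 2 \<in> borel_measurable (PiM (K 2) (\<lambda>_. borel))"
      using S unfolding Y_def K_def
      by (auto intro!: borel_measurable_add measurable_order_stat_Load)
    ultimately show ?thesis using that by auto
  qed
  have "indep_vars (\<lambda>_. borel) Z {0, 1, 2}"
    unfolding Z_def
    using d S(1) meas by (intro indep_vars_blocks[OF indep]) (auto simp: K_def disjoint_family_on_def)
  \<comment> \<open>The only case that needs an argument is \<open>C 0\<close>, which is closed as a
    finite set of codes.\<close>
  moreover have "C j \<in> sets borel" if "j \<in> {0, 1, 2}" for j
    using that E finite_subset[OF subset_UNIV finite_UNIV_req_type]
    by (auto simp: C_def intro!: finite_imp_closed borel_closed)
  ultimately have "prob (\<Inter>j\<in>{0, 1, 2}. Z j -` C j \<inter> space M) =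
      (\<Prod>j\<in>{0, 1, 2}. prob (Z j -` C j \<inter> space M))"
    by (intro indep_varsD_finite[where M'="\<lambda>_. borel"]) auto
  moreover have "Z 0 -` C 0 \<inter> space M = {\<omega> \<in> space M. Q (T \<omega>)}"
    by (auto simp: Z_def Y_def K_def C_def dest: injD[OF inj_of_bool_eq_Hot])
  moreover have "Z 1 -` C 1 \<inter> space M = {\<omega> \<in> space M. available A d \<omega> = B}"
  proof -
    have "{s\<in>{..<d}. restrict (\<lambda>a. source_var T A U X a \<omega>) (K 1) (Avail s) = 1} =
        available A d \<omega>" for \<omega>
      by (auto simp: K_def available_def)
    then show ?thesis by (auto simp: Z_def Y_def C_def)
  qed
  moreover have "Z 2 -` C 2 \<inter> space M =
      {\<omega> \<in> space M. download_time k (\<lambda>s. U s \<omega>) S (X i \<omega>) \<in> E}"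
  proof -
    have "order_stat (\<lambda>s. restrict (\<lambda>a. source_var T A U X a \<omega>) (K 2) (Load s)) S k =
        order_stat (\<lambda>s. U s \<omega>) S k" for \<omega>
      by (intro order_stat_cong) (auto simp: K_def)
    then have "Z 2 \<omega> = download_time k (\<lambda>s. U s \<omega>) S (X i \<omega>)" for \<omega>
      by (simp add: Z_def Y_def K_def download_time_def)
    then show ?thesis by (auto simp: C_def)
  qed
  moreover have "(\<Inter>j\<in>{0, 1, 2}. Z j -` C j \<inter> space M) =
      (Z 0 -` C 0 \<inter> space M) \<inter> (Z 1 -` C 1 \<inter> space M) \<inter> (Z 2 -` C 2 \<inter> space M)"
    by auto
  moreover have "{\<omega> \<in> space M. Q (T \<omega>)} \<inter> {\<omega> \<in> space M. available A d \<omega> = B} \<inter>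
      {\<omega> \<in> space M. download_time k (\<lambda>s. U s \<omega>) S (X i \<omega>) \<in> E} =
    {\<omega> \<in> space M. Q (T \<omega>) \<and> available A d \<omega> = B \<and>
      download_time k (\<lambda>s. U s \<omega>) S (X i \<omega>) \<in> E}"
    by auto
  ultimately show ?thesis by simp
qed

lemma event_available [measurable]:
  assumes "d \<le> D"
  shows "{\<omega> \<in> space M. available A d \<omega> = B} \<in> events"
proof -
  have [measurable]: "{\<omega> \<in> space M. A s \<omega>} \<in> events" if "s \<in> {..<d}" for s
    using assms that by (intro measurable_sources) auto
  have "{\<omega> \<in> space M. available A d \<omega> = B} =
      {\<omega> \<in> space M. B \<subseteq> {..<d} \<and> (\<forall>s\<in>{..<d}. A s \<omega> \<longleftrightarrow> s \<in> B)}"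
    by (auto simp: available_def)
  also have "\<dots> \<in> events" by measurable
  finally show ?thesis .
qed

text \<open>On the event that the available set is \<open>B\<close>, the random set in the download
  time can be replaced by \<open>B\<close>. The factorization and exchangeability then apply to each
  \<open>B\<close> of size \<open>j\<close>.\<close>

lemma prob_type_card_available_download_time:
  assumes d: "d \<le> D" and k: "1 \<le> k" "k \<le> j" "j \<le> d" and E: "E \<in> sets borel"
  shows "{\<omega> \<in> space M. Q (T \<omega>) \<and> card (available A d \<omega>) = j \<and>
      download_time k (\<lambda>s. U s \<omega>) (available A d \<omega>) (X i \<omega>) \<in> E} \<in> events" (is "?W \<in> _")
    and "\<P>(\<omega> in M. Q (T \<omega>) \<and> card (available A d \<omega>) = j \<and>
      download_time k (\<lambda>s. U s \<omega>) (available A d \<omega>) (X i \<omega>) \<in> E) =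
    \<P>(\<omega> in M. Q (T \<omega>)) * avail_prob q d j *
      \<P>(\<omega> in M. download_time k (\<lambda>s. U s \<omega>) {..<j} (X i \<omega>) \<in> E)"
proof -
  let ?I = "{B. B \<subseteq> {..<d} \<and> card B = j}"
  let ?V = "\<lambda>B. {\<omega> \<in> space M. Q (T \<omega>) \<and> available A d \<omega> = B \<and>
      download_time k (\<lambda>s. U s \<omega>) B (X i \<omega>) \<in> E}"
  have fin: "finite ?I" by simp
  have eq: "?W = (\<Union>B\<in>?I. ?V B)"
    by (auto simp: available_def)
  have ev: "?V B \<in> events" if "B \<in> ?I" for B
  proof -
    have [measurable]: "random_variable borel (\<lambda>\<omega>. download_time k (\<lambda>s. U s \<omega>) B (X i \<omega>))"
      using that d k by (intro random_variable_download_time) auto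
    show ?thesis using d E by measurable
  qed
  show "?W \<in> events" unfolding eq using fin ev by (intro sets.finite_UN) auto
  have law: "\<P>(\<omega> in M. download_time k (\<lambda>s. U s \<omega>) B (X i \<omega>) \<in> E) =
      \<P>(\<omega> in M. download_time k (\<lambda>s. U s \<omega>) {..<j} (X i \<omega>) \<in> E)" if "B \<in> ?I" for B
  proof -
    have "measure (distr M borel (\<lambda>\<omega>. download_time k (\<lambda>s. U s \<omega>) B (X i \<omega>))) E =
        measure (distr M borel (\<lambda>\<omega>. download_time k (\<lambda>s. U s \<omega>) {..<j} (X i \<omega>))) E"
      using that d k by (subst distr_download_time_cong[of B "{..<j}"]) auto
    moreover have "measure (distr M borel (\<lambda>\<omega>. download_time k (\<lambda>s. U s \<omega>) S (X i \<omega>))) E =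
        \<P>(\<omega> in M. download_time k (\<lambda>s. U s \<omega>) S (X i \<omega>) \<in> E)"
      if "S \<subseteq> {..<D}" "k \<le> card S" for S
      using random_variable_download_time[of S k i] that k E
      by (subst measure_distr) (auto simp: vimage_def Int_def conj_commute)
    moreover have "B \<subseteq> {..<D}" "{..<j} \<subseteq> {..<D}" using that d k by auto
    ultimately show ?thesis using that k by simp
  qed
  have "prob ?W = (\<Sum>B\<in>?I. prob (?V B))"
    unfolding eq using fin ev
    by (intro finite_measure_finite_Union) (auto simp: disjoint_family_on_def)
  also have "\<dots> = (\<Sum>B\<in>?I. \<P>(\<omega> in M. Q (T \<omega>)) *
      \<P>(\<omega> in M. download_time k (\<lambda>s. U s \<omega>) {..<j} (X i \<omega>) \<in> E) *
      \<P>(\<omega> in M. available A d \<omega> = B))"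
  proof (intro sum.cong refl)
    fix B assume B: "B \<in> ?I"
    then have "B \<subseteq> {..<D}" "k \<le> card B" using d k by auto
    from prob_type_available_download_time[OF d this(1) k(1) this(2) E, of Q B i] law[OF B]
    show "prob (?V B) = \<P>(\<omega> in M. Q (T \<omega>)) *
        \<P>(\<omega> in M. download_time k (\<lambda>s. U s \<omega>) {..<j} (X i \<omega>) \<in> E) *
        \<P>(\<omega> in M. available A d \<omega> = B)"
      by (simp only: mult_ac)
  qed
  also have "\<dots> = \<P>(\<omega> in M. Q (T \<omega>)) *
      \<P>(\<omega> in M. download_time k (\<lambda>s. U s \<omega>) {..<j} (X i \<omega>) \<in> E) *
      (\<Sum>B\<in>?I. \<P>(\<omega> in M. available A d \<omega> = B))"
    by (simp add: sum_distrib_left)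
  \<comment> \<open>The weights of the sets \<open>B\<close> recombine into the binomial probability
    that exactly \<open>j\<close> servers are available.\<close>
  also have "(\<Sum>B\<in>?I. \<P>(\<omega> in M. available A d \<omega> = B)) =
      prob (\<Union>B\<in>?I. {\<omega> \<in> space M. available A d \<omega> = B})"
    using fin d by (intro finite_measure_finite_Union[symmetric]) (auto simp: disjoint_family_on_def)
  also have "(\<Union>B\<in>?I. {\<omega> \<in> space M. available A d \<omega> = B}) =
      {\<omega> \<in> space M. card (available A d \<omega>) = j}"
    by (auto simp: available_def)
  finally show "prob ?W = \<P>(\<omega> in M. Q (T \<omega>)) * avail_prob q d j *
      \<P>(\<omega> in M. download_time k (\<lambda>s. U s \<omega>) {..<j} (X i \<omega>) \<in> E)"
    using prob_available_card[OF d] by (simp add: mult_ac)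
qed

text \<open>Success splits into the disjoint events of exactly \<open>j\<close> available servers;
  \<open>j\<close> stops at \<open>d\<close> because at most \<open>d\<close> servers are
  selected.\<close>

lemma prob_type_success_download_time:
  assumes d: "d \<le> D" and k: "1 \<le> k" and E: "E \<in> sets borel"
  shows "{\<omega> \<in> space M. Q (T \<omega>) \<and> k \<le> card (available A d \<omega>) \<and>
      download_time k (\<lambda>s. U s \<omega>) (available A d \<omega>) (X i \<omega>) \<in> E} \<in> events" (is "?W \<in> _")
    and "\<P>(\<omega> in M. Q (T \<omega>) \<and> k \<le> card (available A d \<omega>) \<and>
      download_time k (\<lambda>s. U s \<omega>) (available A d \<omega>) (X i \<omega>) \<in> E) =
    \<P>(\<omega> in M. Q (T \<omega>)) * (\<Sum>j=k..d. avail_prob q d j *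
      \<P>(\<omega> in M. download_time k (\<lambda>s. U s \<omega>) {..<j} (X i \<omega>) \<in> E))"
proof -
  let ?V = "\<lambda>j. {\<omega> \<in> space M. Q (T \<omega>) \<and> card (available A d \<omega>) = j \<and>
      download_time k (\<lambda>s. U s \<omega>) (available A d \<omega>) (X i \<omega>) \<in> E}"
  have "card (available A d \<omega>) \<le> d" for \<omega>
    using card_mono[of "{..<d}" "available A d \<omega>"] by (auto simp: available_def)
  then have eq: "?W = (\<Union>j\<in>{k..d}. ?V j)" by auto
  have ev: "?V j \<in> events" if "j \<in> {k..d}" for j
    using that assms by (intro prob_type_card_available_download_time) auto
  show "?W \<in> events" unfolding eq using ev by (intro sets.finite_UN) auto
  have "prob ?W = (\<Sum>j=k..d. prob (?V j))"
    unfolding eq using ev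
    by (intro finite_measure_finite_Union) (auto simp: disjoint_family_on_def)
  also have "\<dots> = (\<Sum>j=k..d. \<P>(\<omega> in M. Q (T \<omega>)) * avail_prob q d j *
      \<P>(\<omega> in M. download_time k (\<lambda>s. U s \<omega>) {..<j} (X i \<omega>) \<in> E))"
    using assms by (intro sum.cong refl prob_type_card_available_download_time) auto
  finally show "prob ?W = \<P>(\<omega> in M. Q (T \<omega>)) * (\<Sum>j=k..d. avail_prob q d j *
      \<P>(\<omega> in M. download_time k (\<lambda>s. U s \<omega>) {..<j} (X i \<omega>) \<in> E))"
    by (simp add: sum_distrib_left mult.assoc)
qed

end

theorem mainTheorem3:
  fixes M :: "'a measure"
    and T :: "'a \<Rightarrow> req_type"
    and A :: "nat \<Rightarrow> 'a \<Rightarrow> bool"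
    and U :: "nat \<Rightarrow> 'a \<Rightarrow> real"
    and X Y :: "req_type \<Rightarrow> 'a \<Rightarrow> real"
    and R :: "req_type \<Rightarrow> 'a \<Rightarrow> real"
    and Rjk :: "req_type \<Rightarrow> nat \<Rightarrow> 'a \<Rightarrow> real"
    and p \<delta> \<beta>' \<beta> :: "req_type \<Rightarrow> real"
    and d k :: "req_type \<Rightarrow> nat"
    and q :: real
    and F :: "real \<Rightarrow> real"
    and g Gbar :: "req_type \<Rightarrow> real \<Rightarrow> real"
    and succ :: "req_type \<Rightarrow> 'a \<Rightarrow> bool"
  assumes M: "prob_space M"
    and p: "0 \<le> p Hot" "0 \<le> p Cold" "p Hot + p Cold = 1"
    and T: "\<And>i. \<P>(\<omega> in M. T \<omega> = i) = p i"
    and dk: "\<And>i. 1 \<le> k i" "\<And>i. k i \<le> d i" "k Hot = 1"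
    and q: "0 < q" "q \<le> 1"
    and A: "\<And>s. s < max (d Hot) (d Cold) \<Longrightarrow> \<P>(\<omega> in M. A s \<omega>) = q"
    and U: "\<And>s. s < max (d Hot) (d Cold) \<Longrightarrow> cdf (distr M borel (U s)) = F"
    and F: "\<And>u. u < 0 \<Longrightarrow> F u = 0"
    and \<delta>: "\<And>i. 0 \<le> \<delta> i"
    and Y: "\<And>i. phase_type (distr M borel (Y i))"
    and X: "\<And>i \<omega>. X i \<omega> = \<delta> i + Y i \<omega>"
    and Gbar: "\<And>i w. Gbar i w = \<P>(\<omega> in M. X i \<omega> > w)"
    and g: "\<And>i x. 0 \<le> g i x" "\<And>i. distributed M lborel (X i) (\<lambda>x. ennreal (g i x))"
    and indep: "prob_space.indep_vars M (\<lambda>_. borel) (source_var T A U X)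
      ({RType} \<union> Avail ` {..<max (d Hot) (d Cold)} \<union> Load ` {..<max (d Hot) (d Cold)}
        \<union> range Service)"
    and succ: "\<And>i \<omega>. succ i \<omega> \<longleftrightarrow> k i \<le> card (available A (d i) \<omega>)"
    and R: "\<And>i \<omega>. R i \<omega> = download_time (k i) (\<lambda>s. U s \<omega>) (available A (d i) \<omega>) (X i \<omega>)"
    and Rjk: "\<And>i j \<omega>. Rjk i j \<omega> = download_time (k i) (\<lambda>s. U s \<omega>) {..<j} (X i \<omega>)"
    and \<beta>': "\<And>i. \<beta>' i = p i * (\<Sum>j=k i..d i. avail_prob q (d i) j)"
    and \<beta>: "\<And>i. \<beta> i = \<beta>' i / (\<beta>' Hot + \<beta>' Cold)"
  shows
    "(\<forall>i j. k i \<le> j \<and> j \<le> d i \<longrightarrow>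
        (\<P>(\<omega> in M. card (available A (d i) \<omega>) = j) > 0 \<longrightarrow>
          (\<forall>w. \<P>(\<omega> in M. R i \<omega> > w \<bar> card (available A (d i) \<omega>) = j) = \<P>(\<omega> in M. Rjk i j \<omega> > w))) \<and>
        (\<forall>w\<ge>0. \<P>(\<omega> in M. Rjk i j \<omega> > w) =
          Gbar i w +
          (LBINT u:{0..w}. \<P>(\<omega> in M. order_stat (\<lambda>s. U s \<omega>) {..<j} (k i) > u) * g i (w - u))) \<and>
        (\<forall>u\<ge>0. \<P>(\<omega> in M. order_stat (\<lambda>s. U s \<omega>) {..<j} (k i) > u) =
          (\<Sum>m=0..k i - 1. real (j choose m) * (1 - F u) ^ (j - m) * F u ^ m)))
   \<and> (\<forall>i. (\<forall>w\<ge>0. \<P>(\<omega> in M. R i \<omega> > w \<bar> succ i \<omega>) =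
          (\<Sum>j=k i..d i. avail_prob q (d i) j / (\<Sum>l=k i..d i. avail_prob q (d i) l)
             * \<P>(\<omega> in M. Rjk i j \<omega> > w))) \<and>
        (\<integral>\<^sup>+\<omega>. ennreal (R i \<omega>) \<partial>uniform_measure M {\<omega> \<in> space M. succ i \<omega>}) =
          (\<integral>\<^sup>+w\<in>{0..}. ennreal (\<P>(\<omega> in M. R i \<omega> > w \<bar> succ i \<omega>)) \<partial>lborel) \<and>
        (p i > 0 \<longrightarrow> (\<forall>w. \<P>(\<omega> in M. R (T \<omega>) \<omega> > w \<bar> T \<omega> = i \<and> succ (T \<omega>) \<omega>) =
          \<P>(\<omega> in M. R i \<omega> > w \<bar> succ i \<omega>))))
   \<and> (\<forall>w\<ge>0. \<P>(\<omega> in M. R (T \<omega>) \<omega> > w \<bar> succ (T \<omega>) \<omega>) =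
          \<beta> Hot * \<P>(\<omega> in M. R Hot \<omega> > w \<bar> succ Hot \<omega>) +
          \<beta> Cold * \<P>(\<omega> in M. R Cold \<omega> > w \<bar> succ Cold \<omega>))"
proof -
  define D where "D = max (d Hot) (d Cold)"
  interpret prob_space M by (rule M)
  interpret storage_request M T A U X D q F
    using indep A U by unfold_locales (auto simp: D_def)
  have dD: "d i \<le> D" for i by (cases i) (auto simp: D_def)

  \<comment> \<open>Joint law of type, success and download time\<close>
  define G where "G i j w = \<P>(\<omega> in M. Rjk i j \<omega> > w)" for i j w
  define s where "s i = (\<Sum>l=k i..d i. avail_prob q (d i) l)" for i
  have ap0: "0 \<le> avail_prob q n j" for n j
    using q by (simp add: avail_prob_def)
  have s_pos: "0 < s i" for i
  proof -
    \<comment> \<open>The probability that all \<open>d i\<close> servers are available is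
      \<open>q ^ d i > 0\<close>, and \<open>k i \<le> d i\<close> makes it a summand of
      \<open>s i\<close>.\<close>
    have "0 < avail_prob q (d i) (d i)" using q by (simp add: avail_prob_def)
    also have "\<dots> \<le> s i"
      unfolding s_def using dk(2)[of i] ap0 by (intro member_le_sum) auto
    finally show ?thesis .
  qed

  \<comment> \<open>With \<open>E = UNIV\<close> this gives success probabilities and with
    \<open>E = {w<..}\<close> tails; \<open>Q\<close> either fixes the type or is always
    true.\<close>
  have ev_joint: "{\<omega> \<in> space M. Q (T \<omega>) \<and> succ i \<omega> \<and> R i \<omega> \<in> E} \<in> events"
    and joint: "\<P>(\<omega> in M. Q (T \<omega>) \<and> succ i \<omega> \<and> R i \<omega> \<in> E) =
      \<P>(\<omega> in M. Q (T \<omega>)) * (\<Sum>j=k i..d i. avail_prob q (d i) j * \<P>(\<omega> in M. Rjk i j \<omega> \<in> E))"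
    if "E \<in> sets borel" for Q i E
    using prob_type_success_download_time[OF dD[of i] dk(1)[of i] that, of Q i]
    by (simp_all add: succ R Rjk)
  have ev_succ: "{\<omega> \<in> space M. succ i \<omega>} \<in> events" for i
    using ev_joint[of UNIV "\<lambda>_. True" i] by simp
  have type_succ: "\<P>(\<omega> in M. Q (T \<omega>) \<and> succ i \<omega>) = \<P>(\<omega> in M. Q (T \<omega>)) * s i" for Q i
    using joint[of UNIV Q i] by (simp add: s_def prob_space)
  have prob_succ: "\<P>(\<omega> in M. succ i \<omega>) = s i" for i
    using type_succ[of "\<lambda>_. True" i] by (simp add: prob_space)
  have type_succ_gt: "\<P>(\<omega> in M. Q (T \<omega>) \<and> succ i \<omega> \<and> R i \<omega> > w) =
      \<P>(\<omega> in M. Q (T \<omega>)) * (\<Sum>j=k i..d i. avail_prob q (d i) j * G i j w)" for Q i w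
    using joint[of "{w<..}" Q i] by (simp add: G_def)
  have cond_R: "\<P>(\<omega> in M. R i \<omega> > w \<bar> succ i \<omega>) = (\<Sum>j=k i..d i. avail_prob q (d i) j * G i j w) / s i" for i w
    using type_succ_gt[of "\<lambda>_. True" i w] prob_succ[of i]
    by (simp add: cond_prob_def prob_space conj_commute)
  have type_succ_gt': "\<P>(\<omega> in M. Q (T \<omega>) \<and> succ i \<omega> \<and> R i \<omega> > w) =
      \<P>(\<omega> in M. Q (T \<omega>)) * s i * \<P>(\<omega> in M. R i \<omega> > w \<bar> succ i \<omega>)" for Q i w
    using s_pos[of i] by (simp add: type_succ_gt cond_R)

  \<comment> \<open>Download time for a fixed number of available servers\<close>
  have X_nonneg: "\<P>(\<omega> in M. X i \<omega> < 0) = 0" for i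
  proof -
    have Y_eq: "Y i = (\<lambda>\<omega>. X i \<omega> - \<delta> i)" by (simp add: X fun_eq_iff)
    \<comment> \<open>Measurability of \<open>Y i\<close> comes from that of \<open>X i\<close>,
      from which it differs by a constant.\<close>
    have [measurable]: "random_variable borel (Y i)" unfolding Y_eq by measurable
    have "\<P>(\<omega> in M. Y i \<omega> > 0) = 1"
      using phase_type_positive[OF Y[of i]]
      by (simp add: measure_distr vimage_def Int_def conj_commute)
    moreover have "\<P>(\<omega> in M. \<not> Y i \<omega> > 0) = 1 - \<P>(\<omega> in M. Y i \<omega> > 0)"
      by (intro prob_neg) measurable
    moreover have "\<P>(\<omega> in M. X i \<omega> < 0) \<le> \<P>(\<omega> in M. \<not> Y i \<omega> > 0)"
      using \<delta>[of i] by (intro finite_measure_mono) (auto simp: X)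
    ultimately show ?thesis using measure_nonneg[of M] by (simp add: order_antisym)
  qed

  have order_stat_tail: "\<P>(\<omega> in M. order_stat (\<lambda>s. U s \<omega>) {..<j} (k i) > u) =
      (\<Sum>m=0..k i - 1. real (j choose m) * (1 - F u) ^ (j - m) * F u ^ m)"
    if "k i \<le> j" "j \<le> d i" for i j u
    using prob_order_stat_U_gt[of "{..<j}" "k i" u] that dD[of i] dk(1)[of i] by auto

  have cond_card: "\<P>(\<omega> in M. R i \<omega> > w \<bar> card (available A (d i) \<omega>) = j) = G i j w"
    if "k i \<le> j" "j \<le> d i" "\<P>(\<omega> in M. card (available A (d i) \<omega>) = j) > 0" for i j w
  proof -
    have "\<P>(\<omega> in M. card (available A (d i) \<omega>) = j \<and> R i \<omega> > w) = avail_prob q (d i) j * G i j w"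
      using prob_type_card_available_download_time(2)[OF dD[of i] dk(1)[of i] that(1,2), of "{w<..}" "\<lambda>_. True" i]
      by (simp add: R Rjk G_def prob_space)
    then show ?thesis
      using that(3) prob_available_card[OF dD[of i], of j]
      by (simp add: cond_prob_def conj_commute)
  qed

  have tail: "G i j w = Gbar i w +
      (LBINT u:{0..w}. \<P>(\<omega> in M. order_stat (\<lambda>s. U s \<omega>) {..<j} (k i) > u) * g i (w - u))"
    if "k i \<le> j" "j \<le> d i" for i j w
  proof -
    \<comment> \<open>With \<open>F u = 0\<close> only the term \<open>m = 0\<close> survives, and
      it equals 1 because \<open>0 ^ 0 = 1\<close>.\<close>
    have "\<P>(\<omega> in M. order_stat (\<lambda>s. U s \<omega>) {..<j} (k i) > u) = 1" if "u < 0" for u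
      using order_stat_tail[OF \<open>k i \<le> j\<close> \<open>j \<le> d i\<close>, of u] F[OF that]
      by (simp add: power_0_left if_distrib sum.delta' cong: if_cong)
    then show ?thesis
      using that dD[of i] dk(1)[of i] X_nonneg[of i] g
      unfolding G_def Rjk download_time_def Gbar
      by (intro prob_add_density_gt indep_var_order_stat_service) auto
  qed

  \<comment> \<open>Mean download time as an identity of extended nonnegative integrals\<close>
  have mean: "(\<integral>\<^sup>+\<omega>. ennreal (R i \<omega>) \<partial>uniform_measure M {\<omega> \<in> space M. succ i \<omega>}) =
      (\<integral>\<^sup>+w\<in>{0..}. ennreal (\<P>(\<omega> in M. R i \<omega> > w \<bar> succ i \<omega>)) \<partial>lborel)" for i
  proof -
    \<comment> \<open>With fewer than \<open>k i\<close> available servers, \<open>R i\<close> reads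
      an unspecified list entry. Setting it to 0 there gives a measurable function with the same law
      given success.\<close>
    define f where "f \<omega> = (if succ i \<omega> then R i \<omega> else 0)" for \<omega>
    have f: "f \<in> borel_measurable M"
    proof (rule measurableI)
      fix E :: "real set" assume E: "E \<in> sets borel"
      have "f -` E \<inter> space M = {\<omega> \<in> space M. succ i \<omega> \<and> R i \<omega> \<in> E} \<union>
          (if 0 \<in> E then space M - {\<omega> \<in> space M. succ i \<omega>} else {})"
        by (auto simp: f_def split: if_splits)
      then show "f -` E \<inter> space M \<in> events"
        using ev_joint[OF E, of "\<lambda>_. True" i] ev_succ[of i] by auto
    qed auto
    have cond: "\<P>(\<omega> in M. f \<omega> > w \<bar> succ i \<omega>) = \<P>(\<omega> in M. R i \<omega> > w \<bar> succ i \<omega>)" for w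
      unfolding cond_prob_def
      by (intro arg_cong2[where f="(/)"] arg_cong[where f=prob]) (auto simp: f_def)
    have "(\<integral>\<^sup>+\<omega>. ennreal (R i \<omega>) \<partial>uniform_measure M {\<omega> \<in> space M. succ i \<omega>}) =
        (\<integral>\<^sup>+\<omega>. ennreal (f \<omega>) \<partial>uniform_measure M {\<omega> \<in> space M. succ i \<omega>})"
      using ev_succ[of i] by (intro nn_integral_cong_AE AE_uniform_measureI) (auto simp: f_def)
    also have "\<dots> = (\<integral>\<^sup>+w\<in>{0..}. ennreal (\<P>(\<omega> in M. f \<omega> > w \<bar> succ i \<omega>)) \<partial>lborel)"
      using f ev_succ s_pos prob_succ by (intro nn_integral_uniform_measure_tail) auto
    finally show ?thesis by (simp add: cond)
  qed

  \<comment> \<open>Restriction to one type and the mixture over types\<close>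
  have cond_type: "\<P>(\<omega> in M. R (T \<omega>) \<omega> > w \<bar> T \<omega> = i \<and> succ (T \<omega>) \<omega>) =
      \<P>(\<omega> in M. R i \<omega> > w \<bar> succ i \<omega>)" if "p i > 0" for i w
  proof -
    have "\<P>(\<omega> in M. R (T \<omega>) \<omega> > w \<bar> T \<omega> = i \<and> succ (T \<omega>) \<omega>) =
        \<P>(\<omega> in M. T \<omega> = i \<and> succ i \<omega> \<and> R i \<omega> > w) / \<P>(\<omega> in M. T \<omega> = i \<and> succ i \<omega>)"
      unfolding cond_prob_def
      by (intro arg_cong2[where f="(/)"] arg_cong[where f=prob]) auto
    \<comment> \<open>The common factor \<open>p i * s i\<close> cancels; it is positive by
      \<open>p i > 0\<close>.\<close>
    also have "\<dots> = \<P>(\<omega> in M. R i \<omega> > w \<bar> succ i \<omega>)"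
      using type_succ_gt'[of "\<lambda>t. t = i" i w] type_succ[of "\<lambda>t. t = i" i] that s_pos[of i]
      by (simp add: T)
    finally show ?thesis .
  qed

  have mixture: "\<P>(\<omega> in M. R (T \<omega>) \<omega> > w \<bar> succ (T \<omega>) \<omega>) =
      \<beta> Hot * \<P>(\<omega> in M. R Hot \<omega> > w \<bar> succ Hot \<omega>) +
      \<beta> Cold * \<P>(\<omega> in M. R Cold \<omega> > w \<bar> succ Cold \<omega>)" for w
  proof -
    \<comment> \<open>Once \<open>T \<omega>\<close> is fixed, the random index of
      \<open>succ\<close> and \<open>R\<close> becomes constant. The set \<open>E\<close> stays
      general so that \<open>UNIV\<close> yields the denominator of the conditional probability and
      \<open>{w<..}\<close> its numerator.\<close>
    have split: "\<P>(\<omega> in M. succ (T \<omega>) \<omega> \<and> R (T \<omega>) \<omega> \<in> E) =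
        \<P>(\<omega> in M. T \<omega> = Hot \<and> succ Hot \<omega> \<and> R Hot \<omega> \<in> E) +
        \<P>(\<omega> in M. T \<omega> = Cold \<and> succ Cold \<omega> \<and> R Cold \<omega> \<in> E)"
      if E: "E \<in> sets borel" for E
    proof -
      have "{\<omega> \<in> space M. succ (T \<omega>) \<omega> \<and> R (T \<omega>) \<omega> \<in> E} =
          {\<omega> \<in> space M. T \<omega> = Hot \<and> succ Hot \<omega> \<and> R Hot \<omega> \<in> E} \<union>
          {\<omega> \<in> space M. T \<omega> = Cold \<and> succ Cold \<omega> \<and> R Cold \<omega> \<in> E}"
      proof (rule Set.set_eqI)
        show "\<omega> \<in> {\<omega> \<in> space M. succ (T \<omega>) \<omega> \<and> R (T \<omega>) \<omega> \<in> E} \<longleftrightarrow>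
          \<omega> \<in> {\<omega> \<in> space M. T \<omega> = Hot \<and> succ Hot \<omega> \<and> R Hot \<omega> \<in> E} \<union>
          {\<omega> \<in> space M. T \<omega> = Cold \<and> succ Cold \<omega> \<and> R Cold \<omega> \<in> E}" for \<omega>
          by (cases "T \<omega>") simp_all
      qed
      then show ?thesis
        using ev_joint[OF E, of "\<lambda>t. t = Hot" Hot] ev_joint[OF E, of "\<lambda>t. t = Cold" Cold]
        by (auto intro!: finite_measure_Union)
    qed
    have "\<P>(\<omega> in M. succ (T \<omega>) \<omega>) = \<beta>' Hot + \<beta>' Cold"
      using split[of UNIV] type_succ[of "\<lambda>t. t = Hot" Hot] type_succ[of "\<lambda>t. t = Cold" Cold]
      by (simp add: T \<beta>' s_def)
    moreover have "\<P>(\<omega> in M. succ (T \<omega>) \<omega> \<and> R (T \<omega>) \<omega> > w) =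
        \<beta>' Hot * \<P>(\<omega> in M. R Hot \<omega> > w \<bar> succ Hot \<omega>) +
        \<beta>' Cold * \<P>(\<omega> in M. R Cold \<omega> > w \<bar> succ Cold \<omega>)"
      using split[of "{w<..}"] type_succ_gt'[of "\<lambda>t. t = Hot" Hot w]
        type_succ_gt'[of "\<lambda>t. t = Cold" Cold w]
      by (simp add: T \<beta>' s_def)
    ultimately show ?thesis
      by (simp add: cond_prob_def[of M "\<lambda>\<omega>. R (T \<omega>) \<omega> > w"] \<beta> conj_commute add_divide_distrib)
  qed

  have cond_R': "\<P>(\<omega> in M. R i \<omega> > w \<bar> succ i \<omega>) =
      (\<Sum>j=k i..d i. avail_prob q (d i) j / (\<Sum>l=k i..d i. avail_prob q (d i) l) * G i j w)" for i w
    by (simp add: cond_R s_def sum_divide_distrib)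
  show ?thesis
    by (intro conjI allI impI cond_card[unfolded G_def] tail[unfolded G_def] order_stat_tail
      cond_R'[unfolded G_def] mean cond_type mixture; (elim conjE)?; assumption)
qed

end
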